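(* Let $d_{\max} \in (0,1)$ be given. In the two-asset trading model described in the context, a trading policy $u(\cdot)$ guarantees the prespecified drawdown limit, that is, $d(k) \le d_{\max}$ for all $k$ with probability one, if and only if for all $k$, the condition $$ -\frac{M(k) + r_f(k)}{X_{\max} - r_f(k)}\,V(k) \;\le\; u(k) \;\le\; \frac{M(k) + r_f(k)}{|X_{\min}| + r_f(k)}\,V(k) $$ is satisfied along all sample paths, where $$ M(k) := \frac{d_{\max} - d(k)}{1 - d(k)}. $$
   Context: Fix an integer $N>0$. For stages $k=0,1,\dots,N$, let $S(k)>0$ denote the price of a risky asset, with per-period returns $X(k) := \frac{S(k+1)-S(k)}{S(k)}$. The returns are assumed bounded, $X_{\min} \le X(k) \le X_{\max}$, where $X_{\min}$ and $X_{\max}$ are points in the support, denoted by $\mathcal{X}$, and satisfy $-1 < X_{\min} < 0 < X_{\max}$. The returns are not necessarily independent and can have an arbitrary but bounded distribution with the bounds $X_{\min}$ and $X_{\max}$. A riskless asset has interest rate $r_f(k)$ at stage $k$, with $r_f(k) \in [0, X_{\max}]$ for all $k$ almost surely. A trading policy $u(\cdot)$ specifies at each stage $k$ the amount $u(k)$ invested in the risky asset ($u(k)<0$ stands for short selling), the remainder $V(k)-u(k)$ being held in the riskless asset. Starting from an initial account value $V(0)>0$, the account value $V(k)$ evolves by $$V(k+1) = V(k) + u(k)X(k) + (V(k)-u(k))\,r_f(k).$$ The percentage drawdown up to date $k$ is $$d(k) := \frac{V_{\max}(k) - V(k)}{V_{\max}(k)}, \qquad V_{\max}(k) := \max_{0\le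 i\le k} V(i).$$
   Formalization: X_min and X_max are assumed in the support of X(k) conditionally on every observable event of positive probability (needed for "only if" when returns are dependent); "along all sample paths" is read as almost surely; when r_f(k) = X_max the lower bound is minus infinity. *)

theory Defs
  imports "HOL-Probability.Probability"
begin

text \<open>
  The topological support of a distribution on the real line: the points all of whose open
  neighbourhoods have positive mass.
\<close>

definition dist_support :: "real measure \<Rightarrow> real set" where
  "dist_support \<mu> = {x. \<forall>U. open U \<longrightarrow> x \<in> U \<longrightarrow> 0 < emeasure \<mu> U}"

definition asset_return :: "(nat \<Rightarrow> 'a \<Rightarrow> real) \<Rightarrow> nat \<Rightarrow> 'a \<Rightarrow> real" where
  "asset_return S k \<omega> = (S (Suc k) \<omega> - S k \<omega>) / S k \<omega>"

text \<open>
  The market on the stages \<open>0, \<dots>, N\<close>: \<open>F k\<close> is the information available at stage \<open>k\<close>, which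
  includes the price \<open>S k\<close> and the interest rate \<open>r k\<close> for the period from \<open>k\<close> to \<open>k + 1\<close>.

  Returns may depend on the past arbitrarily.  That \<open>Xmin\<close> and \<open>Xmax\<close> lie in the support is
  understood relative to the available information: conditionally on any event \<open>A\<close> of positive
  probability that is observable at stage \<open>k\<close>, both points belong to the support of the distribution
  of the next return.  The event \<open>A = space M\<close> gives the unconditional support.  The unconditional
  condition alone does not suffice for the drawdown lemma: if, for instance, the return at stage 1
  were a function of the return at stage 0, a policy could exploit this at stage 1 and
  violate the bounds on the investment without any risk of drawdown.
\<close>

locale two_asset_market =
  prob_space M + filtration "space M" F
  for M :: "'a measure" and F :: "nat \<Rightarrow> 'a measure" +
  fixes N :: nat and S r :: "nat \<Rightarrow> 'a \<Rightarrow> real" and Xmin Xmax :: real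
  assumes N_pos: "0 < N"
    and F_subalgebra: "\<And>k. subalgebra M (F k)"
    and price_adapted: "\<And>k. k \<le> N \<Longrightarrow> S k \<in> borel_measurable (F k)"
    and price_pos: "\<And>k \<omega>. k \<le> N \<Longrightarrow> \<omega> \<in> space M \<Longrightarrow> 0 < S k \<omega>"
    and Xmin_bounds: "-1 < Xmin" "Xmin < 0"
    and Xmax_pos: "0 < Xmax"
    and return_bounded: "\<And>k. k < N \<Longrightarrow> AE \<omega> in M. asset_return S k \<omega> \<in> {Xmin..Xmax}"
    and return_support: "\<And>k A. k < N \<Longrightarrow> A \<in> sets (F k) \<Longrightarrow> 0 < emeasure M A \<Longrightarrow>
          {Xmin, Xmax} \<subseteq> dist_support (distr (uniform_measure M A) borel (asset_return S k))"
    and rate_adapted: "\<And>k. k < N \<Longrightarrow> r k \<in> borel_measurable (F k)"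
    and rate_bounded: "\<And>k. k < N \<Longrightarrow> AE \<omega> in M. r k \<omega> \<in> {0..Xmax}"

text \<open>
  A trading policy is causal: the amount \<open>u k \<omega>\<close> invested at stage \<open>k\<close> only depends on the
  information available at that stage.
\<close>

definition trading_policy :: "(nat \<Rightarrow> 'a measure) \<Rightarrow> nat \<Rightarrow> (nat \<Rightarrow> 'a \<Rightarrow> real) \<Rightarrow> bool" where
  "trading_policy F N u \<longleftrightarrow> (\<forall>k<N. u k \<in> borel_measurable (F k))"

primrec account_value ::
    "(nat \<Rightarrow> 'a \<Rightarrow> real) \<Rightarrow> (nat \<Rightarrow> 'a \<Rightarrow> real) \<Rightarrow> (nat \<Rightarrow> 'a \<Rightarrow> real) \<Rightarrow> real \<Rightarrow> nat \<Rightarrow> 'a \<Rightarrow> real" where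
  "account_value S r u v0 0 \<omega> = v0"
| "account_value S r u v0 (Suc k) \<omega> =
     account_value S r u v0 k \<omega> + u k \<omega> * asset_return S k \<omega>
       + (account_value S r u v0 k \<omega> - u k \<omega>) * r k \<omega>"

definition running_max :: "(nat \<Rightarrow> 'a \<Rightarrow> real) \<Rightarrow> nat \<Rightarrow> 'a \<Rightarrow> real" where
  "running_max V k \<omega> = Max ((\<lambda>i. V i \<omega>) ` {0..k})"

definition drawdown :: "(nat \<Rightarrow> 'a \<Rightarrow> real) \<Rightarrow> nat \<Rightarrow> 'a \<Rightarrow> real" where
  "drawdown V k \<omega> = (running_max V k \<omega> - V k \<omega>) / running_max V k \<omega>"

definition drawdown_modulation :: "real \<Rightarrow> (nat \<Rightarrow> 'a \<Rightarrow> real) \<Rightarrow> nat \<Rightarrow> 'a \<Rightarrow> real" where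
  "drawdown_modulation dmax V k \<omega> = (dmax - drawdown V k \<omega>) / (1 - drawdown V k \<omega>)"

text \<open>
  The interest rate may attain the value \<open>Xmax\<close>, in which case the denominator of the lower bound
  vanishes.  The bounds are therefore read in the extended reals, where a positive number divided by
  0 is infinite, so that the lower bound becomes minus infinity and imposes no constraint; division
  by 0 in the type \<^typ>\<open>real\<close> would instead wrongly forbid short selling.
\<close>

definition investment_bounds ::
    "real \<Rightarrow> real \<Rightarrow> real \<Rightarrow> (nat \<Rightarrow> 'a \<Rightarrow> real) \<Rightarrow> (nat \<Rightarrow> 'a \<Rightarrow> real) \<Rightarrow> (nat \<Rightarrow> 'a \<Rightarrow> real) \<Rightarrow>
      nat \<Rightarrow> 'a \<Rightarrow> bool" where
  "investment_bounds dmax Xmin Xmax r V u k \<omega> \<longleftrightarrow>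
     - (ereal (drawdown_modulation dmax V k \<omega> + r k \<omega>) / ereal (Xmax - r k \<omega>)) * ereal (V k \<omega>)
       \<le> ereal (u k \<omega>) \<and>
     ereal (u k \<omega>)
       \<le> ereal (drawdown_modulation dmax V k \<omega> + r k \<omega>) / ereal (\<bar>Xmin\<bar> + r k \<omega>) * ereal (V k \<omega>)"

end

theory Submission
  imports Defs
begin

text \<open>
  Since the running maximum \<open>R\<close> never decreases, the drawdown limit holds up to stage \<open>N\<close> iff
  \<open>(1 - dmax) * R k \<le> V (Suc k)\<close> for all \<open>k < N\<close>.  The next value \<open>V (Suc k)\<close> is an affine function
  of the return \<open>X k\<close> with coefficients known at stage \<open>k\<close>.  As \<open>Xmin\<close> and \<open>Xmax\<close> lie in the
  conditional support of \<open>X k\<close>, which is contained in \<open>{Xmin..Xmax}\<close>, the inequality holds almost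
  surely iff it holds with \<open>X k\<close> replaced by either endpoint.  Because
  \<open>V k - (1 - dmax) * R k = m k * V k\<close> for the drawdown modulation \<open>m\<close>, the two resulting inequalities are the bounds on \<open>u k\<close>.
\<close>

section \<open>Drawdown limits as lower bounds on the account value\<close>

lemma running_max_0: "running_max V 0 \<omega> = V 0 \<omega>"
  by (simp add: running_max_def)

lemma running_max_Suc: "running_max V (Suc k) \<omega> = max (V (Suc k) \<omega>) (running_max V k \<omega>)"
  by (simp add: running_max_def atLeast0_atMost_Suc)

lemma initial_le_running_max: "V 0 \<omega> \<le> running_max V k \<omega>"
  by (simp add: running_max_def)

lemma drawdown_le_iff:
  assumes "0 < running_max V k \<omega>"
  shows "drawdown V k \<omega> \<le> c \<longleftrightarrow> (1 - c) * running_max V k \<omega> \<le> V k \<omega>"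
  using assms by (simp add: drawdown_def divide_simps algebra_simps)

text \<open>The threshold involves the running maximum at \<open>k\<close>, not at
  \<open>Suc k\<close>, so it is already known when \<open>u k\<close> is chosen. If stage
  \<open>Suc k\<close> sets a new maximum, both sides hold; otherwise the running maximum is
  unchanged.\<close>

lemma drawdown_Suc_le_iff:
  assumes "0 < running_max V k \<omega>" and "0 \<le> c" and "c \<le> 1"
  shows "drawdown V (Suc k) \<omega> \<le> c \<longleftrightarrow> (1 - c) * running_max V k \<omega> \<le> V (Suc k) \<omega>"
proof -
  have pos: "0 < running_max V (Suc k) \<omega>"
    using assms(1) by (simp add: running_max_Suc)
  show ?thesis
  proof (cases "V (Suc k) \<omega> \<le> running_max V k \<omega>")
    case True
    then show ?thesis
      unfolding drawdown_le_iff[OF pos] by (simp add: running_max_Suc max_def)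
  next
    case False
    then have "(1 - c) * running_max V k \<omega> \<le> (1 - c) * V (Suc k) \<omega>"
      using assms(3) by (intro mult_left_mono) auto
    moreover have "(1 - c) * V (Suc k) \<omega> \<le> V (Suc k) \<omega>"
      using False assms by (simp add: left_diff_distrib)
    ultimately show ?thesis
      unfolding drawdown_le_iff[OF pos] using False by (simp add: running_max_Suc)
  qed
qed

lemma modulation_times_value:
  assumes "0 < V k \<omega>" and "0 < running_max V k \<omega>"
  shows "drawdown_modulation c V k \<omega> * V k \<omega> = V k \<omega> - (1 - c) * running_max V k \<omega>"
proof -
  have "1 - drawdown V k \<omega> = V k \<omega> / running_max V k \<omega>"
    using assms(2) by (simp add: drawdown_def field_simps)
  then show ?thesis
    using assms by (simp add: drawdown_modulation_def drawdown_def field_simps)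
qed

text \<open>Multiplying by the denominators turns the upper bound into the inequality at
  \<open>Xmin\<close> and the lower bound into the one at \<open>Xmax\<close>. The limit on the
  current drawdown makes the modulation nonnegative, which settles the case of a vanishing
  denominator.\<close>

lemma investment_bounds_iff:
  assumes V: "0 < V k \<omega>" and R: "0 < running_max V k \<omega>" and dd: "drawdown V k \<omega> \<le> dmax"
    and r: "r k \<omega> \<in> {0..Xmax}" and "Xmin < 0" and "0 < Xmax"
  shows "investment_bounds dmax Xmin Xmax r V u k \<omega> \<longleftrightarrow>
    (\<forall>x\<in>{Xmin, Xmax}. (1 - dmax) * running_max V k \<omega>
       \<le> V k \<omega> + u k \<omega> * x + (V k \<omega> - u k \<omega>) * r k \<omega>)"
proof -
  define m where "m = drawdown_modulation dmax V k \<omega>"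
  have mV: "m * V k \<omega> = V k \<omega> - (1 - dmax) * running_max V k \<omega>"
    unfolding m_def using V R by (rule modulation_times_value)
  have "0 \<le> m * V k \<omega>"
    using dd unfolding mV drawdown_le_iff[OF R] by simp
  then have m: "0 \<le> m"
    using V by (simp add: zero_le_mult_iff)
  have upper: "ereal (u k \<omega>) \<le> ereal (m + r k \<omega>) / ereal (\<bar>Xmin\<bar> + r k \<omega>) * ereal (V k \<omega>) \<longleftrightarrow>
      (1 - dmax) * running_max V k \<omega> \<le> V k \<omega> + u k \<omega> * Xmin + (V k \<omega> - u k \<omega>) * r k \<omega>"
  proof -
    have pos: "0 < \<bar>Xmin\<bar> + r k \<omega>"
      using r \<open>Xmin < 0\<close> by auto
    then have "ereal (u k \<omega>) \<le> ereal (m + r k \<omega>) / ereal (\<bar>Xmin\<bar> + r k \<omega>) * ereal (V k \<omega>) \<longleftrightarrow>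
        u k \<omega> \<le> (m + r k \<omega>) * V k \<omega> / (\<bar>Xmin\<bar> + r k \<omega>)"
      by simp
    also have "\<dots> \<longleftrightarrow> u k \<omega> * (\<bar>Xmin\<bar> + r k \<omega>) \<le> (m + r k \<omega>) * V k \<omega>"
      using pos by (rule pos_le_divide_eq)
    finally show ?thesis
      using mV \<open>Xmin < 0\<close> by (simp add: algebra_simps)
  qed
  have lower: "- (ereal (m + r k \<omega>) / ereal (Xmax - r k \<omega>)) * ereal (V k \<omega>) \<le> ereal (u k \<omega>) \<longleftrightarrow>
      (1 - dmax) * running_max V k \<omega> \<le> V k \<omega> + u k \<omega> * Xmax + (V k \<omega> - u k \<omega>) * r k \<omega>"
  proof (cases "r k \<omega> = Xmax")
    case True
    \<comment> \<open>For \<open>r k \<omega> = Xmax\<close> the lower bound is minus infinity, as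
      \<open>m + Xmax > 0\<close>. On the other side \<open>u k \<omega>\<close> cancels, and by
      \<open>mV\<close> this inequality is what remains.\<close>
    have "0 \<le> m * V k \<omega> + V k \<omega> * Xmax"
      using m V \<open>0 < Xmax\<close> by simp
    then show ?thesis
      using True m V \<open>0 < Xmax\<close> mV by (simp add: divide_ereal_def algebra_simps)
  next
    case False
    then have pos: "0 < Xmax - r k \<omega>"
      using r by auto
    then have "- (ereal (m + r k \<omega>) / ereal (Xmax - r k \<omega>)) * ereal (V k \<omega>) \<le> ereal (u k \<omega>) \<longleftrightarrow>
        - ((m + r k \<omega>) * V k \<omega>) / (Xmax - r k \<omega>) \<le> u k \<omega>"
      by simp
    also have "\<dots> \<longleftrightarrow> - ((m + r k \<omega>) * V k \<omega>) \<le> u k \<omega> * (Xmax - r k \<omega>)"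
      using pos by (rule pos_divide_le_eq)
    finally show ?thesis
      using mV by (simp add: algebra_simps)
  qed
  show ?thesis
    unfolding investment_bounds_def m_def[symmetric] using upper lower by auto
qed

section \<open>Affine functions of the return\<close>

lemma affine_ge_between:
  fixes a b c l h x :: real
  assumes "x \<in> {l..h}" and "\<forall>y\<in>{l, h}. c \<le> a + b * y"
  shows "c \<le> a + b * x"
proof (cases "0 \<le> b")
  case True
  then have "b * l \<le> b * x"
    using assms(1) by (intro mult_left_mono) auto
  with assms(2) show ?thesis by auto
next
  case False
  then have "b * h \<le> b * x"
    using assms(1) by (intro mult_left_mono_neg) auto
  with assms(2) show ?thesis by auto
qed

text \<open>The set where the inequality at \<open>x\<close> fails is determined by \<open>a\<close>
  and \<open>b\<close>, hence lies in \<open>G\<close>. If it had positive probability, then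
  conditionally on it \<open>X\<close> would come close enough to \<open>x\<close> with positive
  probability to make \<open>a + b * X\<close> negative.\<close>

lemma (in prob_space) AE_affine_nonneg_at_support_point:
  fixes a b X :: "'a \<Rightarrow> real"
  assumes sub: "subalgebra M G"
    and [measurable]: "a \<in> borel_measurable G" "b \<in> borel_measurable G"
    and X: "X \<in> borel_measurable M"
    and supp: "\<And>A. A \<in> sets G \<Longrightarrow> 0 < emeasure M A \<Longrightarrow>
      x \<in> dist_support (distr (uniform_measure M A) borel X)"
    and nonneg: "AE \<omega> in M. 0 \<le> a \<omega> + b \<omega> * X \<omega>"
  shows "AE \<omega> in M. 0 \<le> a \<omega> + b \<omega> * x"
proof -
  \<comment> \<open>How close \<open>X\<close> must be to \<open>x\<close> varies with \<omega>. A
    slack proportional to |b| makes one radius \<open>e\<close> work on all of \<open>A\<close>; it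
    tends to 0 at the end.\<close>
  have "AE \<omega> in M. 0 \<le> a \<omega> + b \<omega> * x + \<bar>b \<omega>\<bar> * inverse (real (Suc n))" for n
  proof -
    define e where "e = inverse (real (Suc n))"
    define A where "A = {\<omega> \<in> space G. a \<omega> + b \<omega> * x + \<bar>b \<omega>\<bar> * e < 0}"
    have A: "A \<in> sets G"
      unfolding A_def by measurable
    then have A_M: "A \<in> sets M"
      using sub by (auto simp: subalgebra_def)
    have space: "space G = space M"
      using sub by (simp add: subalgebra_def)
    have "emeasure M A = 0"
    proof (rule ccontr)
      assume "emeasure M A \<noteq> 0"
      then have "0 < emeasure M A"
        by (simp add: zero_less_iff_neq_zero)
      then have "x \<in> dist_support (distr (uniform_measure M A) borel X)"
        using A by (rule supp[rotated])
      moreover have "x \<in> ball x e" "open (ball x e)"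
        by (auto simp: e_def)
      ultimately have "0 < emeasure (distr (uniform_measure M A) borel X) (ball x e)"
        unfolding dist_support_def by blast
      also have "\<dots> = emeasure (uniform_measure M A) (X -` ball x e \<inter> space M)"
        using X by (subst emeasure_distr) auto
      also have "\<dots> = emeasure M (A \<inter> (X -` ball x e \<inter> space M)) / emeasure M A"
        using A_M X by (intro emeasure_uniform_measure) (auto intro: measurable_sets)
      finally have pos: "emeasure M (A \<inter> (X -` ball x e \<inter> space M)) \<noteq> 0"
        by auto
      \<comment> \<open>On this set \<open>a + b * X\<close> is at most
        \<open>a + b * x + |b| * e\<close>, which is negative by the choice of
        \<open>A\<close>.\<close>
      have "AE \<omega> in M. \<omega> \<notin> A \<inter> (X -` ball x e \<inter> space M)"
        using nonneg
      proof eventually_elim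
        case (elim \<omega>)
        show ?case
        proof
          assume \<omega>: "\<omega> \<in> A \<inter> (X -` ball x e \<inter> space M)"
          have "b \<omega> * (X \<omega> - x) \<le> \<bar>b \<omega>\<bar> * \<bar>X \<omega> - x\<bar>"
            by (metis abs_ge_self abs_mult)
          also have "\<dots> \<le> \<bar>b \<omega>\<bar> * e"
            using \<omega> by (intro mult_left_mono) (auto simp: dist_real_def)
          finally show False
            using \<omega> elim by (simp add: A_def right_diff_distrib)
        qed
      qed
      moreover have "A \<inter> (X -` ball x e \<inter> space M) \<in> sets M"
        using A_M X by (auto intro: measurable_sets)
      ultimately show False
        using pos by (simp add: AE_iff_measurable[OF _ refl] Int_def conj_ac cong: conj_cong)
    qed
    then have "AE \<omega> in M. \<omega> \<notin> A"
      using A_M by (intro AE_not_in) (auto simp: null_sets_def)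
    then show ?thesis
      using AE_space by eventually_elim (auto simp: A_def e_def space not_less)
  qed
  then have "AE \<omega> in M. \<forall>n. 0 \<le> a \<omega> + b \<omega> * x + \<bar>b \<omega>\<bar> * inverse (real (Suc n))"
    by (simp add: AE_all_countable)
  then show ?thesis
  proof eventually_elim
    case (elim \<omega>)
    have "(\<lambda>n. a \<omega> + b \<omega> * x + \<bar>b \<omega>\<bar> * inverse (real (Suc n)))
        \<longlonglongrightarrow> a \<omega> + b \<omega> * x + \<bar>b \<omega>\<bar> * 0"
      by (intro tendsto_intros LIMSEQ_inverse_real_of_nat)
    then show ?case
      using elim by (intro LIMSEQ_le_const[where a = 0]) auto
  qed
qed

section \<open>Adaptedness and reduction to the two extreme returns\<close>

context two_asset_market
begin

lemma measurable_F_mono: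
  assumes "i \<le> k" and "f \<in> borel_measurable (F i)"
  shows "f \<in> borel_measurable (F k)"
  using assms by (metis measurable_from_subalg sets_F_mono space_F subalgebra_def)

lemma measurable_F_M: "f \<in> borel_measurable (F k) \<Longrightarrow> f \<in> borel_measurable M"
  using F_subalgebra measurable_from_subalg by blast

lemma asset_return_adapted:
  assumes "k < N"
  shows "asset_return S k \<in> borel_measurable (F (Suc k))"
proof -
  have [measurable]: "S k \<in> borel_measurable (F (Suc k))" "S (Suc k) \<in> borel_measurable (F (Suc k))"
    using assms by (simp_all add: price_adapted measurable_F_mono[OF _ price_adapted[of k]])
  show ?thesis
    unfolding asset_return_def[abs_def] by measurable
qed

lemma account_value_adapted:
  assumes "trading_policy F N u" and "k \<le> N"
  shows "account_value S r u v0 k \<in> borel_measurable (F k)"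
  using assms(2)
proof (induction k)
  case 0
  then show ?case by simp
next
  case (Suc k)
  have "account_value S r u v0 k \<in> borel_measurable (F k)" "u k \<in> borel_measurable (F k)"
      "r k \<in> borel_measurable (F k)"
    using assms(1) Suc by (auto simp: trading_policy_def rate_adapted)
  \<comment> \<open>The return over the period from \<open>k\<close> is only known at
    \<open>Suc k\<close>, so the other ingredients are lifted to \<open>F (Suc k)\<close>.\<close>
  note [measurable] = this[THEN measurable_F_mono[of k "Suc k", rotated]]
    asset_return_adapted[of k]
  show ?case
    using Suc.prems by simp
qed

lemma running_max_account_value_adapted:
  assumes "trading_policy F N u" and "k \<le> N"
  shows "running_max (account_value S r u v0) k \<in> borel_measurable (F k)"
  unfolding running_max_def[abs_def] using assms
  by (intro borel_measurable_Max measurable_F_mono[OF _ account_value_adapted]) auto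

text \<open>Left to right rests on the conditional support of the return, which requires the
  threshold \<open>c\<close> to be known at stage \<open>k\<close>. Right to left uses that an
  affine function on an interval is minimal at an endpoint.\<close>

lemma AE_account_value_ge_iff_endpoints:
  assumes u: "trading_policy F N u" and "k < N" and [measurable]: "c \<in> borel_measurable (F k)"
  shows "(AE \<omega> in M. c \<omega> \<le> account_value S r u v0 (Suc k) \<omega>) \<longleftrightarrow>
    (AE \<omega> in M. \<forall>x\<in>{Xmin, Xmax}. c \<omega> \<le> account_value S r u v0 k \<omega> + u k \<omega> * x
       + (account_value S r u v0 k \<omega> - u k \<omega>) * r k \<omega>)"
    (is "?L \<longleftrightarrow> (AE \<omega> in M. \<forall>x\<in>_. ?P \<omega> x)")
proof
  define V where "V = account_value S r u v0 k"
  \<comment> \<open>Everything known at stage \<open>k\<close> except the slope \<open>u k\<close>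
    is collected in \<open>a\<close>, so that the claim has the form
    \<open>0 \<le> a + u k * X\<close>.\<close>
  define a where "a \<omega> = V \<omega> + (V \<omega> - u k \<omega>) * r k \<omega> - c \<omega>" for \<omega>
  have [measurable]: "u k \<in> borel_measurable (F k)" "r k \<in> borel_measurable (F k)"
      "V \<in> borel_measurable (F k)"
    using u \<open>k < N\<close> by (auto simp: V_def trading_policy_def rate_adapted account_value_adapted)
  have a: "a \<in> borel_measurable (F k)"
    unfolding a_def by measurable
  assume ?L
  then have "AE \<omega> in M. 0 \<le> a \<omega> + u k \<omega> * asset_return S k \<omega>"
    by eventually_elim (simp add: a_def V_def)
  then have "AE \<omega> in M. 0 \<le> a \<omega> + u k \<omega> * x" if "x \<in> {Xmin, Xmax}" for x
    using that return_support[OF \<open>k < N\<close>] asset_return_adapted[OF \<open>k < N\<close>]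
    by (intro AE_affine_nonneg_at_support_point[OF F_subalgebra a \<open>u k \<in> _\<close>])
       (auto intro: measurable_F_M)
  then have "AE \<omega> in M. \<forall>x\<in>{Xmin, Xmax}. 0 \<le> a \<omega> + u k \<omega> * x"
    by auto
  then show "AE \<omega> in M. \<forall>x\<in>{Xmin, Xmax}. ?P \<omega> x"
    by eventually_elim (auto simp: a_def V_def)
next
  assume "AE \<omega> in M. \<forall>x\<in>{Xmin, Xmax}. ?P \<omega> x"
  then show ?L
    using return_bounded[OF \<open>k < N\<close>]
  proof eventually_elim
    case (elim \<omega>)
    then show ?case
      using affine_ge_between[of "asset_return S k \<omega>" Xmin Xmax "c \<omega>"
          "account_value S r u v0 k \<omega> + (account_value S r u v0 k \<omega> - u k \<omega>) * r k \<omega>" "u k \<omega>"]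
      by (simp add: algebra_simps)
  qed
qed

end

theorem lemma3p1:
  fixes M :: "'a measure" and F :: "nat \<Rightarrow> 'a measure" and N :: nat
    and S r u :: "nat \<Rightarrow> 'a \<Rightarrow> real" and Xmin Xmax v0 dmax :: real
  assumes "two_asset_market M F N S r Xmin Xmax"
    and "trading_policy F N u"
    and "0 < v0"
    and "0 < dmax" and "dmax < 1"
  shows "let V = account_value S r u v0 in
     (AE \<omega> in M. \<forall>k\<le>N. drawdown V k \<omega> \<le> dmax) \<longleftrightarrow>
     (AE \<omega> in M. \<forall>k<N. investment_bounds dmax Xmin Xmax r V u k \<omega>)"
proof -
  interpret two_asset_market M F N S r Xmin Xmax
    by fact
  define V where "V = account_value S r u v0"
  define endpoints where "endpoints k \<omega> \<longleftrightarrow> (\<forall>x\<in>{Xmin, Xmax}. (1 - dmax) * running_max V k \<omega>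
      \<le> V k \<omega> + u k \<omega> * x + (V k \<omega> - u k \<omega>) * r k \<omega>)" for k \<omega>
  have R: "0 < running_max V k \<omega>" for k \<omega>
    using \<open>0 < v0\<close> initial_le_running_max[of V \<omega> k] by (simp add: V_def)
  have dd_0: "drawdown V 0 \<omega> \<le> dmax" for \<omega>
    using \<open>0 < dmax\<close> by (simp add: drawdown_def running_max_0)
  have dd_Suc: "drawdown V (Suc k) \<omega> \<le> dmax \<longleftrightarrow> (1 - dmax) * running_max V k \<omega> \<le> V (Suc k) \<omega>"
    for k \<omega>
    using R assms(4,5) by (intro drawdown_Suc_le_iff) auto
  have step: "(AE \<omega> in M. drawdown V (Suc k) \<omega> \<le> dmax) \<longleftrightarrow> (AE \<omega> in M. endpoints k \<omega>)"
    if "k < N" for k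
    unfolding dd_Suc endpoints_def unfolding V_def using that assms(2)
    by (intro AE_account_value_ge_iff_endpoints borel_measurable_times borel_measurable_const
        running_max_account_value_adapted) auto
  \<comment> \<open>An arbitrary policy may ruin the account; the drawdown limit at \<open>k\<close>
    ensures that \<open>V k \<omega>\<close> is positive, so that the bounds on \<open>u k\<close>
    can be multiplied out.\<close>
  have bounds: "investment_bounds dmax Xmin Xmax r V u k \<omega> \<longleftrightarrow> endpoints k \<omega>"
    if "drawdown V k \<omega> \<le> dmax" "r k \<omega> \<in> {0..Xmax}" for k \<omega>
  proof -
    have "0 < (1 - dmax) * running_max V k \<omega>"
      using R \<open>dmax < 1\<close> by simp
    also have "\<dots> \<le> V k \<omega>"
      using that(1) drawdown_le_iff[OF R] by blast
    finally show ?thesis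
      unfolding endpoints_def using that R Xmin_bounds Xmax_pos
      by (intro investment_bounds_iff) auto
  qed
  have rate: "AE \<omega> in M. \<forall>k<N. r k \<omega> \<in> {0..Xmax}"
    using rate_bounded by (auto simp: AE_all_countable)
  have "(AE \<omega> in M. \<forall>k\<le>N. drawdown V k \<omega> \<le> dmax) \<longleftrightarrow>
     (AE \<omega> in M. \<forall>k<N. investment_bounds dmax Xmin Xmax r V u k \<omega>)"
  proof
    assume dd: "AE \<omega> in M. \<forall>k\<le>N. drawdown V k \<omega> \<le> dmax"
    have "AE \<omega> in M. endpoints k \<omega>" if "k < N" for k
    proof -
      have "AE \<omega> in M. drawdown V (Suc k) \<omega> \<le> dmax"
        using dd by eventually_elim (use that in auto)
      then show ?thesis
        using step[OF that] by simp
    qed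
    then have "AE \<omega> in M. \<forall>k<N. endpoints k \<omega>"
      by (auto simp: AE_all_countable)
    with dd rate show "AE \<omega> in M. \<forall>k<N. investment_bounds dmax Xmin Xmax r V u k \<omega>"
      by eventually_elim (auto simp: bounds)
  next
    assume bd: "AE \<omega> in M. \<forall>k<N. investment_bounds dmax Xmin Xmax r V u k \<omega>"
    \<comment> \<open>Induction is needed here because \<open>bounds\<close> applies at stage
      \<open>k\<close> only once the drawdown limit is known there; in the converse direction the
      limit is assumed at all stages.\<close>
    have "AE \<omega> in M. drawdown V k \<omega> \<le> dmax" if "k \<le> N" for k
      using that
    proof (induction k)
      case 0
      then show ?case by (simp add: dd_0)
    next
      case (Suc k)
      then have "AE \<omega> in M. drawdown V k \<omega> \<le> dmax"
        by simp
      with bd rate have "AE \<omega> in M. endpoints k \<omega>"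
        by eventually_elim (use Suc.prems in \<open>auto simp: bounds[symmetric]\<close>)
      then show ?case
        using step Suc.prems by simp
    qed
    then show "AE \<omega> in M. \<forall>k\<le>N. drawdown V k \<omega> \<le> dmax"
      by (auto simp: AE_all_countable)
  qed
  then show ?thesis
    by (simp add: V_def Let_def)
qed

end
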